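(* Let $\mathbb{I}$ be a category and let $\mathbb{C}$ be a category with pullbacks and with wide pullbacks of families of monomorphisms (with common codomain) indexed by the morphisms of $\mathbb{I}$. Let $\sqsubset$ be a pre-cover relation on $\mathbb{C}$ satisfying the following condition: if $f\sqsubset g$ and the composite $fe$ is defined, then $fe\sqsubset g$. Let $\sqsubset^{\mathbb{I}}$ be the induced componentwise pre-cover relation on the functor category $\mathbb{C}^{\mathbb{I}}$. Let $g:B\to C$ be a morphism in $\mathbb{C}^{\mathbb{I}}$. If each component $g_X:B(X)\to C(X)$ of $g$ (for $X$ an object of $\mathbb{I}$) admits an image with respect to $\sqsubset$, then $g$ admits an image $(\mathrm{Im}(g),\mathrm{im}(g))$ with respect to $\sqsubset^{\mathbb{I}}$. Moreover, when this is the case, for each object $X$ in $\mathbb{I}$ the object $(\mathrm{Im}(g)(X),\mathrm{im}(g)_X)$ is the product in the comma category $(\mathbb{C}\downarrow C(X))$ of the family $(W_i,w_i)_{i\in\mathcal{I}}$, where $\mathcal{I}$ is the collection of all morphisms of $\mathbb{I}$ with domain $X$ and where, for each $i:X\to Y$ in $\mathcal{I}$, the morphism $w_i:W_i\to C(X)$ is the monomorphism obtained by pulling back $\mathrm{im}(g_Y):\mathrm{Im}(g_Y)\to C(Y)$ along $C(i):C(X)\to C(Y)$; that is, there is a pullback square with projections $w_i:W_i\to C(X)$ and $\tilde{i}:W_i\to \mathrm{Im}(g_Y)$ satisfying $C(i)\,w_i=\mathrm{im}(g_Y)\,\tilde{i}$.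
   Context: A pre-cover relation $\sqsubset$ on a category $\mathbb{C}$ is a relation on the class of morphisms of $\mathbb{C}$ such that if $f\sqsubset g$ then $f$ and $g$ have the same codomain. Given a pre-cover relation $\sqsubset$ on $\mathbb{C}$, the image of a morphism $g:B\to C$ (with respect to $\sqsubset$) is a terminal object in the full subcategory of the comma (slice) category $(\mathbb{C}\downarrow C)$ whose objects are the pairs $(A,f)$, with $f:A\to C$, such that $f\sqsubset g$. When it exists it is denoted $(\mathrm{Im}(g),\mathrm{im}(g))$, so $\mathrm{im}(g):\mathrm{Im}(g)\to C$; it is determined up to isomorphism. When $\sqsubset$ satisfies the condition that $f\sqsubset g$ implies $fe\sqsubset g$ whenever $fe$ is defined, the morphism $\mathrm{im}(g)$ is a monomorphism. For a category $\mathbb{I}$, the induced pre-cover relation $\sqsubset^{\mathbb{I}}$ on $\mathbb{C}^{\mathbb{I}}$ is defined componentwise: for natural transformations $f:A\to C$ and $g:B\to C$ between functors $\mathbb{I}\to\mathbb{C}$, $f\sqsubset^{\mathbb{I}} g$ if and only if $f_X\sqsubset g_X$ for every object $X$ of $\mathbb{I}$. The image of a morphism of $\mathbb{C}^{\mathbb{I}}$ is taken with respect to $\sqsubset^{\mathbb{I}}$. A wide pullback of a family of morphisms with common codomain $D$ is the product of that family in $(\mathbb{C}\downarrow D)$. *)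

theory Defs
  imports Main "HOL-Library.FuncSet"
begin

text \<open>Categories are given by carrier sets of objects and arrows; \<open>Comp C g f\<close> is the
  composite \<open>g f\<close> (first \<open>f\<close>, then \<open>g\<close>).  Operations are unconstrained off the carriers.\<close>

record ('o, 'm) cat =
  Ob :: "'o set"
  Arr :: "'m set"
  Dom :: "'m \<Rightarrow> 'o"
  Cod :: "'m \<Rightarrow> 'o"
  Ide :: "'o \<Rightarrow> 'm"
  Comp :: "'m \<Rightarrow> 'm \<Rightarrow> 'm"

definition hom :: "('o, 'm) cat \<Rightarrow> 'o \<Rightarrow> 'o \<Rightarrow> 'm set" where
  "hom C A B = {f \<in> Arr C. Dom C f = A \<and> Cod C f = B}"

locale category =
  fixes C :: "('o, 'm) cat"
  assumes Dom_in: "f \<in> Arr C \<Longrightarrow> Dom C f \<in> Ob C"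
    and Cod_in: "f \<in> Arr C \<Longrightarrow> Cod C f \<in> Ob C"
    and Ide_hom: "A \<in> Ob C \<Longrightarrow> Ide C A \<in> hom C A A"
    and Comp_hom: "\<lbrakk>f \<in> hom C X Y; g \<in> hom C Y Z\<rbrakk> \<Longrightarrow> Comp C g f \<in> hom C X Z"
    and Comp_Ide: "f \<in> hom C X Y \<Longrightarrow> Comp C f (Ide C X) = f"
    and Ide_Comp: "f \<in> hom C X Y \<Longrightarrow> Comp C (Ide C Y) f = f"
    and Comp_assoc: "\<lbrakk>f \<in> hom C X Y; g \<in> hom C Y Z; h \<in> hom C Z V\<rbrakk>
      \<Longrightarrow> Comp C (Comp C h g) f = Comp C h (Comp C g f)"

definition monic :: "('o, 'm) cat \<Rightarrow> 'm \<Rightarrow> bool" where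
  "monic C m \<longleftrightarrow> m \<in> Arr C \<and>
    (\<forall>A. \<forall>a \<in> hom C A (Dom C m). \<forall>b \<in> hom C A (Dom C m). Comp C m a = Comp C m b \<longrightarrow> a = b)"

definition terminal :: "('o, 'm) cat \<Rightarrow> 'o \<Rightarrow> bool" where
  "terminal C T \<longleftrightarrow> T \<in> Ob C \<and> (\<forall>A \<in> Ob C. \<exists>!f. f \<in> hom C A T)"

definition is_product ::
    "('o, 'm) cat \<Rightarrow> 'j set \<Rightarrow> ('j \<Rightarrow> 'o) \<Rightarrow> 'o \<Rightarrow> ('j \<Rightarrow> 'm) \<Rightarrow> bool" where
  "is_product C J A P p \<longleftrightarrow> P \<in> Ob C \<and> (\<forall>j \<in> J. p j \<in> hom C P (A j)) \<and>
    (\<forall>Q \<in> Ob C. \<forall>q. (\<forall>j \<in> J. q j \<in> hom C Q (A j)) \<longrightarrow>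
      (\<exists>!u. u \<in> hom C Q P \<and> (\<forall>j \<in> J. Comp C (p j) u = q j)))"

text \<open>\<open>is_pullback C f g P p q\<close>: the square \<open>f p = g q\<close> with vertex \<open>P\<close> is a pullback, so
  \<open>p\<close> is the pullback of \<open>g\<close> along \<open>f\<close>.\<close>

definition is_pullback ::
    "('o, 'm) cat \<Rightarrow> 'm \<Rightarrow> 'm \<Rightarrow> 'o \<Rightarrow> 'm \<Rightarrow> 'm \<Rightarrow> bool" where
  "is_pullback C f g P p q \<longleftrightarrow>
    f \<in> Arr C \<and> g \<in> Arr C \<and> Cod C f = Cod C g \<and> P \<in> Ob C \<and>
    p \<in> hom C P (Dom C f) \<and> q \<in> hom C P (Dom C g) \<and> Comp C f p = Comp C g q \<and>
    (\<forall>Q \<in> Ob C. \<forall>a \<in> hom C Q (Dom C f). \<forall>b \<in> hom C Q (Dom C g).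
      Comp C f a = Comp C g b \<longrightarrow>
      (\<exists>!u. u \<in> hom C Q P \<and> Comp C p u = a \<and> Comp C q u = b))"

definition has_pullbacks :: "('o, 'm) cat \<Rightarrow> bool" where
  "has_pullbacks C \<longleftrightarrow> (\<forall>f \<in> Arr C. \<forall>g \<in> Arr C. Cod C f = Cod C g \<longrightarrow>
    (\<exists>P p q. is_pullback C f g P p q))"

definition full_subcat :: "('o, 'm) cat \<Rightarrow> 'o set \<Rightarrow> ('o, 'm) cat" where
  "full_subcat C S = C\<lparr>Ob := Ob C \<inter> S, Arr := {f \<in> Arr C. Dom C f \<in> S \<and> Cod C f \<in> S}\<rparr>"

text \<open>The comma category of \<open>C\<close> over \<open>D\<close>.  An arrow carries its source and target, since
  the same arrow of \<open>C\<close> may underlie several arrows over \<open>D\<close>.\<close>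

definition slice ::
    "('o, 'm) cat \<Rightarrow> 'o \<Rightarrow> ('o \<times> 'm, ('o \<times> 'm) \<times> 'm \<times> ('o \<times> 'm)) cat" where
  "slice C D = \<lparr>
    Ob = {(A, f). f \<in> hom C A D},
    Arr = {((A, f), k, (B, h)) | A f k B h.
      f \<in> hom C A D \<and> h \<in> hom C B D \<and> k \<in> hom C A B \<and> Comp C h k = f},
    Dom = (\<lambda>(a, k, b). a),
    Cod = (\<lambda>(a, k, b). b),
    Ide = (\<lambda>(A, f). ((A, f), Ide C A, (A, f))),
    Comp = (\<lambda>(b, l, c) (a, k, b'). (a, Comp C l k, c))\<rparr>"

definition is_wide_pullback ::
    "('o, 'm) cat \<Rightarrow> 'o \<Rightarrow> 'j set \<Rightarrow> ('j \<Rightarrow> 'm) \<Rightarrow>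
      'o \<times> 'm \<Rightarrow> ('j \<Rightarrow> ('o \<times> 'm) \<times> 'm \<times> ('o \<times> 'm)) \<Rightarrow> bool" where
  "is_wide_pullback C D J m P p \<longleftrightarrow> is_product (slice C D) J (\<lambda>j. (Dom C (m j), m j)) P p"

definition has_wide_pullbacks_of_monos :: "('o, 'm) cat \<Rightarrow> 'j set \<Rightarrow> bool" where
  "has_wide_pullbacks_of_monos C J \<longleftrightarrow>
    (\<forall>D \<in> Ob C. \<forall>m. (\<forall>j \<in> J. monic C (m j) \<and> Cod C (m j) = D) \<longrightarrow>
      (\<exists>P p. is_wide_pullback C D J m P p))"

text \<open>The maps of a functor and the components of a natural transformation are required to be
  \<open>extensional\<close> on the relevant carriers, so that HOL equality of these records is equality of
  functors and of natural transformations.\<close>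

record ('oi, 'mi, 'oc, 'mc) ftor =
  fobj :: "'oi \<Rightarrow> 'oc"
  farr :: "'mi \<Rightarrow> 'mc"

definition is_functor ::
    "('oi, 'mi) cat \<Rightarrow> ('oc, 'mc) cat \<Rightarrow> ('oi, 'mi, 'oc, 'mc) ftor \<Rightarrow> bool" where
  "is_functor I C F \<longleftrightarrow>
    fobj F \<in> Ob I \<rightarrow>\<^sub>E Ob C \<and> farr F \<in> Arr I \<rightarrow>\<^sub>E Arr C \<and>
    (\<forall>i \<in> Arr I. farr F i \<in> hom C (fobj F (Dom I i)) (fobj F (Cod I i))) \<and>
    (\<forall>X \<in> Ob I. farr F (Ide I X) = Ide C (fobj F X)) \<and>
    (\<forall>i \<in> Arr I. \<forall>j \<in> Arr I. Dom I j = Cod I i \<longrightarrow>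
      farr F (Comp I j i) = Comp C (farr F j) (farr F i))"

record ('oi, 'mi, 'oc, 'mc) ntrans =
  src :: "('oi, 'mi, 'oc, 'mc) ftor"
  trg :: "('oi, 'mi, 'oc, 'mc) ftor"
  component :: "'oi \<Rightarrow> 'mc"

definition is_ntrans ::
    "('oi, 'mi) cat \<Rightarrow> ('oc, 'mc) cat \<Rightarrow> ('oi, 'mi, 'oc, 'mc) ntrans \<Rightarrow> bool" where
  "is_ntrans I C t \<longleftrightarrow>
    is_functor I C (src t) \<and> is_functor I C (trg t) \<and>
    component t \<in> extensional (Ob I) \<and>
    (\<forall>X \<in> Ob I. component t X \<in> hom C (fobj (src t) X) (fobj (trg t) X)) \<and>
    (\<forall>i \<in> Arr I. Comp C (farr (trg t) i) (component t (Dom I i))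
      = Comp C (component t (Cod I i)) (farr (src t) i))"

definition functor_cat ::
    "('oi, 'mi) cat \<Rightarrow> ('oc, 'mc) cat \<Rightarrow>
      (('oi, 'mi, 'oc, 'mc) ftor, ('oi, 'mi, 'oc, 'mc) ntrans) cat" where
  "functor_cat I C = \<lparr>
    Ob = {F. is_functor I C F},
    Arr = {t. is_ntrans I C t},
    Dom = src,
    Cod = trg,
    Ide = (\<lambda>F. \<lparr>src = F, trg = F, component = (\<lambda>X \<in> Ob I. Ide C (fobj F X))\<rparr>),
    Comp = (\<lambda>s t. \<lparr>src = src t, trg = trg s,
      component = (\<lambda>X \<in> Ob I. Comp C (component s X) (component t X))\<rparr>)\<rparr>"

definition precover :: "('o, 'm) cat \<Rightarrow> ('m \<Rightarrow> 'm \<Rightarrow> bool) \<Rightarrow> bool" where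
  "precover C R \<longleftrightarrow> (\<forall>f g. R f g \<longrightarrow> f \<in> Arr C \<and> g \<in> Arr C \<and> Cod C f = Cod C g)"

definition is_image ::
    "('o, 'm) cat \<Rightarrow> ('m \<Rightarrow> 'm \<Rightarrow> bool) \<Rightarrow> 'm \<Rightarrow> 'o \<Rightarrow> 'm \<Rightarrow> bool" where
  "is_image C R g A f \<longleftrightarrow>
    terminal (full_subcat (slice C (Cod C g)) {(A', f'). R f' g}) (A, f)"

text \<open>The equality of codomains is not implied by the componentwise condition.\<close>

definition induced_precover ::
    "('oi, 'mi) cat \<Rightarrow> ('oc, 'mc) cat \<Rightarrow> ('mc \<Rightarrow> 'mc \<Rightarrow> bool) \<Rightarrow>
      ('oi, 'mi, 'oc, 'mc) ntrans \<Rightarrow> ('oi, 'mi, 'oc, 'mc) ntrans \<Rightarrow> bool" where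
  "induced_precover I C R f g \<longleftrightarrow>
    f \<in> Arr (functor_cat I C) \<and> g \<in> Arr (functor_cat I C) \<and>
    Cod (functor_cat I C) f = Cod (functor_cat I C) g \<and>
    (\<forall>X \<in> Ob I. R (component f X) (component g X))"

lemma precover_induced: "precover (functor_cat I C) (induced_precover I C R)"
  by (simp add: precover_def induced_precover_def)

lemma category_full_subcat:
  assumes "category C"
  shows "category (full_subcat C S)"
proof -
  interpret category C by fact
  show ?thesis
    by unfold_locales
      (use Dom_in Cod_in Ide_hom Comp_hom Comp_Ide Ide_Comp Comp_assoc in
        \<open>fastforce simp: full_subcat_def hom_def\<close>)+
qed

lemma category_slice:
  assumes "category C"
  shows "category (slice C D)"
proof -
  interpret category C by fact
  have arr: "x \<in> Arr (slice C D) \<longleftrightarrow> (\<exists>A f k B h. x = ((A, f), k, (B, h)) \<and>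
      f \<in> hom C A D \<and> h \<in> hom C B D \<and> k \<in> hom C A B \<and> Comp C h k = f)" for x
    by (simp add: slice_def)
  have hm: "x \<in> hom (slice C D) a b \<longleftrightarrow> (\<exists>A f k B h. a = (A, f) \<and> b = (B, h) \<and>
      x = ((A, f), k, (B, h)) \<and>
      f \<in> hom C A D \<and> h \<in> hom C B D \<and> k \<in> hom C A B \<and> Comp C h k = f)" for x a b
    by (auto simp: hom_def[of "slice C D"] arr) (auto simp: slice_def)
  have ops: "Dom (slice C D) (a, k, b) = a" "Cod (slice C D) (a, k, b) = b"
      "(A, f) \<in> Ob (slice C D) \<longleftrightarrow> f \<in> hom C A D"
      "Ide (slice C D) (A, f) = ((A, f), Ide C A, (A, f))"
      "Comp (slice C D) (b, l, c) (a, k, b') = (a, Comp C l k, c)" for A f a k b b' l c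
    by (auto simp: slice_def)
  show ?thesis
  proof (unfold_locales, goal_cases)
    case (1 f) then show ?case by (auto simp: arr ops)
  next
    case (2 f) then show ?case by (auto simp: arr ops)
  next
    case (3 A)
    then obtain A' f where f: "A = (A', f)" "f \<in> hom C A' D" by (auto simp: slice_def)
    then have "A' \<in> Ob C" using Dom_in by (auto simp: hom_def)
    with f show ?case by (simp add: hm ops Ide_hom Comp_Ide[OF f(2)])
  next
    case (4 f X Y g Z)
    then obtain A a k B b l E e where *: "X = (A, a)" "Y = (B, b)" "Z = (E, e)"
      "f = (X, k, Y)" "g = (Y, l, Z)" "a \<in> hom C A D" "b \<in> hom C B D" "e \<in> hom C E D"
      "k \<in> hom C A B" "l \<in> hom C B E" "Comp C b k = a" "Comp C e l = b"
      unfolding hm by blast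
    then have "Comp C l k \<in> hom C A E" "Comp C e (Comp C l k) = a"
      using Comp_hom Comp_assoc[of k A B l E e D] by auto
    with * show ?case by (simp add: hm ops)
  next
    case (5 f X Y)
    then obtain A a k B b where "X = (A, a)" "f = (X, k, Y)" "k \<in> hom C A B"
      unfolding hm by blast
    then show ?case by (simp add: ops Comp_Ide[of k A B])
  next
    case (6 f X Y)
    then obtain A k B b where "Y = (B, b)" "f = (X, k, Y)" "k \<in> hom C A B"
      unfolding hm by blast
    then show ?case by (simp add: ops Ide_Comp[of k A B])
  next
    case (7 f X Y g Z h V)
    then obtain A B E G k l n where "f = (X, k, Y)" "g = (Y, l, Z)" "h = (Z, n, V)"
      "k \<in> hom C A B" "l \<in> hom C B E" "n \<in> hom C E G"
      unfolding hm by blast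
    then show ?case by (simp add: ops Comp_assoc[of k A B l E n G])
  qed
qed

lemma category_functor_cat:
  assumes "category I" and "category C"
  shows "category (functor_cat I C)"
proof -
  interpret I: category I by fact
  interpret C: category C by fact
  have ide: "is_ntrans I C \<lparr>src = F, trg = F, component = (\<lambda>X \<in> Ob I. Ide C (fobj F X))\<rparr>"
    if F: "is_functor I C F" for F
  proof -
    have "Comp C (farr F i) (Ide C (fobj F (Dom I i)))
        = Comp C (Ide C (fobj F (Cod I i))) (farr F i)" if "i \<in> Arr I" for i
      using F that by (metis is_functor_def C.Comp_Ide C.Ide_Comp)
    then show ?thesis
      using F C.Ide_hom I.Dom_in I.Cod_in
      by (auto simp: is_ntrans_def is_functor_def PiE_def Pi_def)
  qed
  have comp: "is_ntrans I C \<lparr>src = src t, trg = trg s,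
      component = (\<lambda>X \<in> Ob I. Comp C (component s X) (component t X))\<rparr>"
    if s: "is_ntrans I C s" and t: "is_ntrans I C t" and st: "src s = trg t" for s t
  proof -
    have "Comp C (farr (trg s) i) (Comp C (component s (Dom I i)) (component t (Dom I i)))
        = Comp C (Comp C (component s (Cod I i)) (component t (Cod I i))) (farr (src t) i)"
      if i: "i \<in> Arr I" for i
    proof -
      let ?X = "Dom I i" and ?Y = "Cod I i"
      have X: "?X \<in> Ob I" and Y: "?Y \<in> Ob I"
        using i I.Dom_in I.Cod_in by auto
      have t1: "component t ?X \<in> hom C (fobj (src t) ?X) (fobj (trg t) ?X)"
        and t2: "component t ?Y \<in> hom C (fobj (src t) ?Y) (fobj (trg t) ?Y)"
        and s1: "component s ?X \<in> hom C (fobj (trg t) ?X) (fobj (trg s) ?X)"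
        and s2: "component s ?Y \<in> hom C (fobj (trg t) ?Y) (fobj (trg s) ?Y)"
        and a: "farr (src t) i \<in> hom C (fobj (src t) ?X) (fobj (src t) ?Y)"
        and b: "farr (trg t) i \<in> hom C (fobj (trg t) ?X) (fobj (trg t) ?Y)"
        and c: "farr (trg s) i \<in> hom C (fobj (trg s) ?X) (fobj (trg s) ?Y)"
        and n1: "Comp C (farr (trg t) i) (component t ?X) = Comp C (component t ?Y) (farr (src t) i)"
        and n2: "Comp C (farr (trg s) i) (component s ?X) = Comp C (component s ?Y) (farr (trg t) i)"
        using s t st i X Y by (auto simp: is_ntrans_def is_functor_def)
      show ?thesis
        using C.Comp_assoc[OF t1 s1 c] C.Comp_assoc[OF t1 b s2] C.Comp_assoc[OF a t2 s2] n1 n2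
        by simp
    qed
    then show ?thesis
      using s t st C.Comp_hom I.Dom_in I.Cod_in
      by (auto simp: is_ntrans_def)
  qed
  show ?thesis
  proof (unfold_locales, goal_cases)
    case (3 A)
    then show ?case using ide by (simp add: functor_cat_def hom_def)
  next
    case (4 f X Y g Z)
    then show ?case using comp[of g f] by (auto simp: functor_cat_def hom_def)
  next
    case (5 f X Y)
    then have f: "is_ntrans I C f" "src f = X" "trg f = Y" by (auto simp: functor_cat_def hom_def)
    have "(\<lambda>U \<in> Ob I. Comp C (component f U) (Ide C (fobj X U))) = component f"
    proof (rule extensionalityI[of _ "Ob I"])
      fix U assume U: "U \<in> Ob I"
      with f have "component f U \<in> hom C (fobj X U) (fobj Y U)" by (auto simp: is_ntrans_def)
      with U show "(\<lambda>U \<in> Ob I. Comp C (component f U) (Ide C (fobj X U))) U = component f U" by (simp add: C.Comp_Ide)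
    qed (use f in \<open>auto simp: is_ntrans_def\<close>)
    with f show ?case by (auto simp: functor_cat_def cong: restrict_cong)
  next
    case (6 f X Y)
    then have f: "is_ntrans I C f" "src f = X" "trg f = Y" by (auto simp: functor_cat_def hom_def)
    have "(\<lambda>U \<in> Ob I. Comp C (Ide C (fobj Y U)) (component f U)) = component f"
    proof (rule extensionalityI[of _ "Ob I"])
      fix U assume U: "U \<in> Ob I"
      with f have "component f U \<in> hom C (fobj X U) (fobj Y U)" by (auto simp: is_ntrans_def)
      with U show "(\<lambda>U \<in> Ob I. Comp C (Ide C (fobj Y U)) (component f U)) U = component f U" by (simp add: C.Ide_Comp)
    qed (use f in \<open>auto simp: is_ntrans_def\<close>)
    with f show ?case by (auto simp: functor_cat_def cong: restrict_cong)
  next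
    case (7 f X Y g Z h V)
    then have fgh: "is_ntrans I C f" "src f = X" "trg f = Y" "is_ntrans I C g" "src g = Y"
      "trg g = Z" "is_ntrans I C h" "src h = Z" "trg h = V"
      by (auto simp: functor_cat_def hom_def)
    have "Comp C (Comp C (component h U) (component g U)) (component f U)
        = Comp C (component h U) (Comp C (component g U) (component f U))" if U: "U \<in> Ob I" for U
    proof (rule C.Comp_assoc)
      show "component f U \<in> hom C (fobj X U) (fobj Y U)"
        and "component g U \<in> hom C (fobj Y U) (fobj Z U)"
        and "component h U \<in> hom C (fobj Z U) (fobj V U)"
        using fgh U by (auto simp: is_ntrans_def)
    qed
    then show ?case
      by (auto simp: functor_cat_def intro!: restrict_ext)
  qed (auto simp: functor_cat_def is_ntrans_def)
qed

end

theory Submission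
  imports Defs
begin

text \<open>The idea is to treat monomorphisms as subobjects, which are determined by the arrows that
  factor through them. Closure of the pre-cover relation under precomposition makes the images
  \<open>m Y = im (g Y)\<close> monic, and every arrow \<open>f\<close> with \<open>f \<sqsubset> g Y\<close> factors
  through \<open>m Y\<close>. Writing \<open>K\<close> for the codomain of \<open>g\<close>, the image of
  \<open>g\<close> has to be the largest subfunctor of \<open>K\<close> whose value at each \<open>Y\<close>
  is contained in \<open>m Y\<close>.

  Such a subfunctor has at \<open>X\<close> a monomorphism \<open>s\<close> through which \<open>v\<close>
  factors precisely when \<open>K(i) v\<close> factors through \<open>m Y\<close> for every
  \<open>i : X \<rightarrow> Y\<close>; the predicate \<open>is_core\<close> expresses this. By the universal
  property of the pullback, the condition for a single \<open>i\<close> says that \<open>v\<close> factors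
  through the pullback \<open>w i\<close> of \<open>m Y\<close> along \<open>K(i)\<close>. Since a product of
  monomorphisms in a slice is the same as their intersection
  (\<open>slice_product_of_monos_iff\<close>), the arrow \<open>s\<close> is a core exactly when it is the
  product of the \<open>w i\<close> (\<open>core_iff_product\<close>).

  The cores are stable under \<open>K\<close>: the condition defining the core at the codomain of
  \<open>j\<close> involves only composites \<open>K(i) K(j) = K(i j)\<close>. Hence they form a subfunctor
  (\<open>subfunctor_of_monos\<close>). The identity of \<open>X\<close> shows that it lies inside \<open>m\<close>,
  so that it is below \<open>g\<close>; naturality of an arbitrary \<open>f \<sqsubset> g\<close> gives
  \<open>K(i) f(X) = f(Y) A(i)\<close>, where \<open>A\<close> is the domain of \<open>f\<close>; this factors through
  \<open>m Y\<close>, so \<open>f\<close> factors through the subfunctor (\<open>functor_image_exists\<close>).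
  Finally, any other image is isomorphic to this one and so also has cores as components
  (\<open>functor_image_components_core\<close>), which yields the description as a product for every
  choice of images and pullbacks.\<close>

section \<open>Factoring through a monomorphism\<close>

definition factors :: "('o, 'm) cat \<Rightarrow> 'm \<Rightarrow> 'm \<Rightarrow> bool" where
  "factors C v m \<longleftrightarrow> (\<exists>u \<in> hom C (Dom C v) (Dom C m). Comp C m u = v)"

lemma homD: "f \<in> hom C A B \<Longrightarrow> f \<in> Arr C \<and> Dom C f = A \<and> Cod C f = B"
  by (simp add: hom_def)

lemma monicD:
  "\<lbrakk>monic C m; a \<in> hom C A (Dom C m); b \<in> hom C A (Dom C m); Comp C m a = Comp C m b\<rbrakk> \<Longrightarrow> a = b"
  unfolding monic_def by blast

context category
begin

lemma Ide_simps: "A \<in> Ob C \<Longrightarrow> Dom C (Ide C A) = A \<and> Cod C (Ide C A) = A \<and> Ide C A \<in> Arr C"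
  using Ide_hom by (auto simp: hom_def)

lemma arr_hom: "f \<in> Arr C \<Longrightarrow> f \<in> hom C (Dom C f) (Cod C f)"
  by (simp add: hom_def)

lemma factors_trans:
  assumes "factors C v m" "factors C m n" "n \<in> Arr C"
  shows "factors C v n"
proof -
  obtain u w where u: "u \<in> hom C (Dom C v) (Dom C m)" "Comp C m u = v"
    and w: "w \<in> hom C (Dom C m) (Dom C n)" "Comp C n w = m"
    using assms by (auto simp: factors_def)
  have "Comp C n (Comp C w u) = v"
    using Comp_assoc[OF u(1) w(1) arr_hom[OF assms(3)]] u w by simp
  then show ?thesis
    using Comp_hom[OF u(1) w(1)] by (auto simp: factors_def)
qed

lemma factors_precomp:
  assumes "factors C v m" "m \<in> Arr C" "e \<in> Arr C" "Cod C e = Dom C v"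
  shows "factors C (Comp C v e) m"
proof -
  obtain u where u: "u \<in> hom C (Dom C v) (Dom C m)" "Comp C m u = v"
    using assms by (auto simp: factors_def)
  have e: "e \<in> hom C (Dom C e) (Dom C v)"
    using assms by (simp add: hom_def)
  have ue: "Comp C u e \<in> hom C (Dom C e) (Dom C m)"
    using Comp_hom[OF e u(1)] .
  have eq: "Comp C m (Comp C u e) = Comp C v e"
    using Comp_assoc[OF e u(1) arr_hom[OF assms(2)]] u by simp
  have "Dom C (Comp C v e) = Dom C e"
    using homD[OF Comp_hom[OF ue arr_hom[OF assms(2)]]] eq by simp
  then show ?thesis
    using ue eq by (auto simp: factors_def)
qed

lemma factors_refl: "m \<in> Arr C \<Longrightarrow> factors C m m"
  unfolding factors_def using Ide_hom Dom_in Comp_Ide arr_hom by blast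

section \<open>Pullbacks and products in a slice, in terms of factoring\<close>

text \<open>If \<open>p a = p b\<close>, then \<open>m q a = m q b\<close> and so \<open>q a = q b\<close>; an arrow into the vertex is
  determined by its two projections.\<close>

lemma pullback_of_monic:
  assumes pb: "is_pullback C f m P p q" and m: "monic C m"
  shows "monic C p"
  unfolding monic_def
proof (intro conjI allI ballI impI)
  show "p \<in> Arr C"
    using pb by (simp add: is_pullback_def hom_def)
  have p: "p \<in> hom C P (Dom C f)" and q: "q \<in> hom C P (Dom C m)"
    and eq: "Comp C f p = Comp C m q" and f: "f \<in> hom C (Dom C f) (Cod C f)"
    and mh: "m \<in> hom C (Dom C m) (Cod C f)"
    using pb by (auto simp: is_pullback_def hom_def)
  fix A a b
  assume "a \<in> hom C A (Dom C p)" "b \<in> hom C A (Dom C p)" and ab: "Comp C p a = Comp C p b"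
  then have a: "a \<in> hom C A P" and b: "b \<in> hom C A P"
    using homD[OF p] by auto
  have "Comp C m (Comp C q a) = Comp C m (Comp C q b)"
    using Comp_assoc[OF a p f] Comp_assoc[OF b p f] Comp_assoc[OF a q mh] Comp_assoc[OF b q mh]
      ab eq by simp
  then have qq: "Comp C q a = Comp C q b"
    using monicD[OF m] Comp_hom[OF a q] Comp_hom[OF b q] by blast
  have "A \<in> Ob C"
    using homD[OF a] Dom_in by auto
  moreover have "Comp C p a \<in> hom C A (Dom C f)" "Comp C q a \<in> hom C A (Dom C m)"
    using Comp_hom a p q by blast+
  moreover have "Comp C f (Comp C p a) = Comp C m (Comp C q a)"
    using Comp_assoc[OF a p f] Comp_assoc[OF a q mh] eq by simp
  ultimately have "\<exists>!u. u \<in> hom C A P \<and> Comp C p u = Comp C p a \<and> Comp C q u = Comp C q a"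
    using pb unfolding is_pullback_def by blast
  then show "a = b"
    using a b ab qq by metis
qed

text \<open>This is the elementwise reading of a pullback as an inverse image: \<open>v\<close> lies in the inverse
  image of \<open>m\<close> under \<open>f\<close> iff \<open>f v\<close> lies in \<open>m\<close>.\<close>

lemma factors_pullback_iff:
  assumes pb: "is_pullback C f m P p q" and v: "v \<in> hom C V (Dom C f)"
  shows "factors C v p \<longleftrightarrow> factors C (Comp C f v) m"
proof -
  have p: "p \<in> hom C P (Dom C f)" and q: "q \<in> hom C P (Dom C m)"
    and eq: "Comp C f p = Comp C m q" and f: "f \<in> hom C (Dom C f) (Cod C f)"
    and mh: "m \<in> hom C (Dom C m) (Cod C f)"
    using pb by (auto simp: is_pullback_def hom_def)
  have dom: "Dom C (Comp C f v) = V" "Dom C v = V" "Dom C p = P"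
    using homD[OF Comp_hom[OF v f]] homD[OF v] homD[OF p] by auto
  have "V \<in> Ob C"
    using homD[OF v] Dom_in by auto
  then have "\<exists>u. u \<in> hom C V P \<and> Comp C p u = v"
    if "b \<in> hom C V (Dom C m)" "Comp C m b = Comp C f v" for b
    using pb v that unfolding is_pullback_def by metis
  moreover have "Comp C q u \<in> hom C V (Dom C m) \<and> Comp C m (Comp C q u) = Comp C f v"
    if u: "u \<in> hom C V P" "Comp C p u = v" for u
    using Comp_hom[OF u(1) q] Comp_assoc[OF u(1) q mh] Comp_assoc[OF u(1) p f] eq u by simp
  ultimately show ?thesis
    unfolding factors_def dom by blast
qed

end

lemma Ob_slice: "a \<in> Ob (slice C D) \<longleftrightarrow> snd a \<in> hom C (fst a) D"
  by (auto simp: slice_def)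

text \<open>Writing the objects with projections instead of as explicit pairs lets this rule rewrite
  hom sets between arbitrary objects of the slice.\<close>

lemma hom_slice:
  "x \<in> hom (slice C D) a b \<longleftrightarrow> (\<exists>k. x = (a, k, b) \<and>
    snd a \<in> hom C (fst a) D \<and> snd b \<in> hom C (fst b) D \<and> k \<in> hom C (fst a) (fst b) \<and>
    Comp C (snd b) k = snd a)"
  unfolding hom_def[of "slice C D"] by (cases a; cases b) (auto simp: slice_def)

lemma Comp_slice: "Comp (slice C D) (b, l, c) (a, k, b') = (a, Comp C l k, c)"
  by (simp add: slice_def)

context category
begin

text \<open>Between an arrow and a monomorphism over \<open>D\<close> there is at most one arrow of the slice, so the
  universal property of a product of monomorphisms reduces to the mere existence of
  factorizations. That \<open>s\<close> is itself monic follows because two arrows equalized by \<open>s\<close> have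
  the same source over \<open>D\<close> and the same projections to each \<open>m j\<close>. In particular, the product of
  the empty family is an isomorphism onto \<open>D\<close>.\<close>

lemma slice_product_of_monos_iff:
  assumes m: "\<And>j. j \<in> J \<Longrightarrow> monic C (m j) \<and> m j \<in> hom C (A j) D"
    and s: "s \<in> hom C S D"
  shows "(\<exists>p. is_product (slice C D) J (\<lambda>j. (A j, m j)) (S, s) p) \<longleftrightarrow>
    monic C s \<and> (\<forall>V. \<forall>v \<in> hom C V D. factors C v s \<longleftrightarrow> (\<forall>j \<in> J. factors C v (m j)))"
    (is "?L \<longleftrightarrow> ?R")
proof
  have dm: "Dom C (m j) = A j" if "j \<in> J" for j
    using m[OF that] homD by fast
  have ds: "Dom C s = S" "s \<in> Arr C"
    using s homD by fast+
  {
    assume ?L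
    then obtain p where "is_product (slice C D) J (\<lambda>j. (A j, m j)) (S, s) p" ..
    then have ph: "\<And>j. j \<in> J \<Longrightarrow> p j \<in> hom (slice C D) (S, s) (A j, m j)"
      and univ: "\<And>Q q. \<lbrakk>Q \<in> Ob (slice C D); \<And>j. j \<in> J \<Longrightarrow> q j \<in> hom (slice C D) Q (A j, m j)\<rbrakk>
        \<Longrightarrow> \<exists>!u. u \<in> hom (slice C D) Q (S, s) \<and> (\<forall>j \<in> J. Comp (slice C D) (p j) u = q j)"
      unfolding is_product_def by blast+
    define k where "k j = fst (snd (p j))" for j
    have k: "p j = ((S, s), k j, (A j, m j))" "k j \<in> hom C S (A j)" "Comp C (m j) (k j) = s"
      if "j \<in> J" for j
      using ph[OF that] by (auto simp: hom_slice k_def)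
    show ?R
    proof (intro conjI allI ballI)
      show "monic C s"
        unfolding monic_def
      proof (intro conjI allI ballI impI)
        show "s \<in> Arr C" by fact
        fix V a b
        assume "a \<in> hom C V (Dom C s)" "b \<in> hom C V (Dom C s)"
          and ab: "Comp C s a = Comp C s b"
        then have a: "a \<in> hom C V S" and b: "b \<in> hom C V S"
          by (auto simp: ds)
        \<comment> \<open>Since \<open>s a = s b\<close>, both \<open>a\<close> and \<open>b\<close> are arrows of the slice out of the
          same object \<open>Q\<close>.\<close>
        define Q where "Q = (V, Comp C s a)"
        have Q: "Q \<in> Ob (slice C D)"
          using Comp_hom[OF a s] by (simp add: Ob_slice Q_def)
        have arr: "(Q, a, (S, s)) \<in> hom (slice C D) Q (S, s)" "(Q, b, (S, s)) \<in> hom (slice C D) Q (S, s)"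
          using a b s ab Comp_hom[OF a s] by (auto simp: hom_slice Q_def)
        have kab: "Comp C (k j) a = Comp C (k j) b" if j: "j \<in> J" for j
        proof (rule monicD[of C "m j"])
          show "Comp C (m j) (Comp C (k j) a) = Comp C (m j) (Comp C (k j) b)"
            using Comp_assoc[OF a k(2)[OF j], of "m j" D] Comp_assoc[OF b k(2)[OF j], of "m j" D]
              m[OF j] k(3)[OF j] ab by simp
        qed (use m[OF j] k(2)[OF j] a b Comp_hom dm[OF j] in auto)
        define q where "q j = Comp (slice C D) (p j) (Q, a, (S, s))" for j
        have q: "q j = (Q, Comp C (k j) a, (A j, m j))" if "j \<in> J" for j
          by (simp add: q_def k(1)[OF that] Comp_slice)
        have "q j \<in> hom (slice C D) Q (A j, m j)" if j: "j \<in> J" for j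
          using Comp_hom[OF a s] Comp_hom[OF a k(2)[OF j]] m[OF j] k(3)[OF j]
            Comp_assoc[OF a k(2)[OF j], of "m j" D]
          by (simp add: hom_slice q[OF j]) (simp add: Q_def)
        from univ[OF Q this]
        have "\<exists>!u. u \<in> hom (slice C D) Q (S, s) \<and> (\<forall>j \<in> J. Comp (slice C D) (p j) u = q j)"
          by blast
        moreover have "\<forall>j \<in> J. Comp (slice C D) (p j) (Q, a, (S, s)) = q j"
          by (simp add: q_def)
        moreover have "\<forall>j \<in> J. Comp (slice C D) (p j) (Q, b, (S, s)) = q j"
          by (simp add: q k(1) Comp_slice kab)
        ultimately have "(Q, a, (S, s)) = (Q, b, (S, s))"
          using arr by blast
        then show "a = b" by simp
      qed
      fix V v
      assume v: "v \<in> hom C V D"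
      show "factors C v s \<longleftrightarrow> (\<forall>j \<in> J. factors C v (m j))"
      proof (intro iffI ballI)
        fix j assume j: "j \<in> J" and "factors C v s"
        moreover have "factors C s (m j)"
          using k[OF j] by (auto simp: factors_def ds dm[OF j])
        moreover have "m j \<in> Arr C"
          using m[OF j] homD by fast
        ultimately show "factors C v (m j)"
          using factors_trans by blast
      next
        assume "\<forall>j \<in> J. factors C v (m j)"
        then have "\<forall>j \<in> J. \<exists>u. u \<in> hom C V (A j) \<and> Comp C (m j) u = v"
          using homD[OF v] dm by (fastforce simp: factors_def)
        then obtain u where u: "\<And>j. j \<in> J \<Longrightarrow> u j \<in> hom C V (A j) \<and> Comp C (m j) (u j) = v"
          by metis
        have "\<exists>!x. x \<in> hom (slice C D) (V, v) (S, s) \<and>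
          (\<forall>j \<in> J. Comp (slice C D) (p j) x = ((V, v), u j, (A j, m j)))"
          by (rule univ) (use u v m in \<open>auto simp: Ob_slice hom_slice\<close>)
        then show "factors C v s"
          using homD[OF v] ds by (auto simp: hom_slice factors_def)
      qed
    qed
  next
    assume r: ?R
    then have mono: "monic C s"
      and fac: "\<And>V v. v \<in> hom C V D \<Longrightarrow> factors C v s \<longleftrightarrow> (\<forall>j \<in> J. factors C v (m j))"
      by blast+
    have "\<forall>j \<in> J. \<exists>k. k \<in> hom C S (A j) \<and> Comp C (m j) k = s"
      using fac[OF s] factors_refl[of s] ds dm by (fastforce simp: factors_def)
    then obtain k where k: "\<And>j. j \<in> J \<Longrightarrow> k j \<in> hom C S (A j) \<and> Comp C (m j) (k j) = s"
      by metis
    define p where "p j = ((S, s), k j, (A j, m j))" for j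
    have "is_product (slice C D) J (\<lambda>j. (A j, m j)) (S, s) p"
      unfolding is_product_def
    proof (intro conjI ballI allI impI)
      show "(S, s) \<in> Ob (slice C D)"
        using s by (simp add: Ob_slice)
      show "p j \<in> hom (slice C D) (S, s) (A j, m j)" if "j \<in> J" for j
        using k[OF that] m[OF that] s by (simp add: hom_slice p_def)
      fix Q q
      assume "Q \<in> Ob (slice C D)" and q: "\<forall>j \<in> J. q j \<in> hom (slice C D) Q (A j, m j)"
      then obtain V v where Q: "Q = (V, v)" and v: "v \<in> hom C V D"
        by (cases Q) (simp add: Ob_slice)
      have "factors C v (m j)" if "j \<in> J" for j
        using q that homD[OF v] dm[OF that] by (fastforce simp: hom_slice Q factors_def)
      then have "factors C v s"
        using fac[OF v] by blast
      then obtain u where u: "u \<in> hom C V S" "Comp C s u = v"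
        using homD[OF v] ds by (auto simp: factors_def)
      show "\<exists>!x. x \<in> hom (slice C D) Q (S, s) \<and> (\<forall>j \<in> J. Comp (slice C D) (p j) x = q j)"
      proof (intro ex1I conjI ballI)
        show "(Q, u, (S, s)) \<in> hom (slice C D) Q (S, s)"
          using u v s by (simp add: hom_slice Q)
        fix j assume j: "j \<in> J"
        then obtain l where l: "q j = (Q, l, (A j, m j))" "l \<in> hom C V (A j)" "Comp C (m j) l = v"
          using q by (fastforce simp: hom_slice Q)
        have "Comp C (k j) u = l"
        proof (rule monicD[of C "m j"])
          show "Comp C (m j) (Comp C (k j) u) = Comp C (m j) l"
            using Comp_assoc[OF u(1), of "k j" "A j" "m j" D] k[OF j] m[OF j] u l by simp
        qed (use k[OF j] m[OF j] u l dm[OF j] Comp_hom in auto)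
        then show "Comp (slice C D) (p j) (Q, u, (S, s)) = q j"
          by (simp add: p_def Comp_slice l)
      next
        fix x
        assume "x \<in> hom (slice C D) Q (S, s) \<and> (\<forall>j \<in> J. Comp (slice C D) (p j) x = q j)"
        then obtain u' where "x = (Q, u', (S, s))" "u' \<in> hom C V S" "Comp C s u' = v"
          by (auto simp: hom_slice Q)
        then show "x = (Q, u, (S, s))"
          using monicD[OF mono, of u V u'] u ds by simp
      qed
    qed
    then show ?L by blast
  }
qed

end

section \<open>Images as universal arrows\<close>

text \<open>The pre-cover relation already forces \<open>f\<close> and every competitor \<open>f'\<close> to have the codomain of
  \<open>g\<close>, so the slice and its subcategory disappear from the description of an image.\<close>

lemma is_image_iff:
  assumes "precover C R"
  shows "is_image C R g A f \<longleftrightarrow> R f g \<and> Dom C f = A \<and>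
    (\<forall>f'. R f' g \<longrightarrow> (\<exists>!u. u \<in> hom C (Dom C f') A \<and> Comp C f u = f'))"
proof -
  let ?F = "full_subcat (slice C (Cod C g)) {(A', f'). R f' g}"
  have cov: "f' \<in> Arr C \<and> Cod C f' = Cod C g" if "R f' g" for f'
    using assms that by (auto simp: precover_def)
  have ob: "a \<in> Ob ?F \<longleftrightarrow> R (snd a) g \<and> fst a = Dom C (snd a)" for a
    by (cases a) (auto simp: full_subcat_def Ob_slice hom_def dest: cov)
  have hm: "x \<in> hom ?F a b \<longleftrightarrow> (\<exists>k. x = (a, k, b) \<and> k \<in> hom C (fst a) (fst b) \<and>
      Comp C (snd b) k = snd a)" if ab: "a \<in> Ob ?F" "b \<in> Ob ?F" for x a b
  proof -
    have "x \<in> hom ?F a b \<longleftrightarrow> x \<in> hom (slice C (Cod C g)) a b"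
      using ab unfolding ob by (auto simp: hom_def full_subcat_def split_beta)
    also have "\<dots> \<longleftrightarrow> (\<exists>k. x = (a, k, b) \<and> k \<in> hom C (fst a) (fst b) \<and> Comp C (snd b) k = snd a)"
      using ab cov unfolding ob hom_slice by (auto simp: hom_def)
    finally show ?thesis .
  qed
  have un: "(\<exists>!x. x \<in> hom ?F a (A, f)) \<longleftrightarrow>
      (\<exists>!u. u \<in> hom C (fst a) A \<and> Comp C f u = snd a)" if "a \<in> Ob ?F" "(A, f) \<in> Ob ?F" for a
    unfolding hm[OF that] by auto
  show ?thesis
  proof (cases "(A, f) \<in> Ob ?F")
    case True
    have "is_image C R g A f \<longleftrightarrow> (\<forall>a \<in> Ob ?F. \<exists>!u. u \<in> hom C (fst a) A \<and> Comp C f u = snd a)"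
      using True un by (simp add: is_image_def terminal_def)
    also have "\<dots> \<longleftrightarrow> (\<forall>f'. R f' g \<longrightarrow> (\<exists>!u. u \<in> hom C (Dom C f') A \<and> Comp C f u = f'))"
      unfolding Ball_def ob by auto
    finally show ?thesis
      using True unfolding ob by auto
  next
    case False
    then show ?thesis
      unfolding ob by (auto simp: is_image_def terminal_def ob)
  qed
qed

text \<open>If \<open>f a = f b\<close>, then this composite is below \<open>g\<close> by closure under precomposition, and its
  factorization through the terminal \<open>f\<close> is unique.\<close>

lemma (in category) image_monic:
  assumes R: "precover C R" and im: "is_image C R g A f"
    and comp: "\<And>e. \<lbrakk>e \<in> Arr C; Cod C e = Dom C f\<rbrakk> \<Longrightarrow> R (Comp C f e) g"
  shows "monic C f"
  unfolding monic_def
proof (intro conjI allI ballI impI)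
  have f: "R f g" "Dom C f = A"
    and u: "\<And>f'. R f' g \<Longrightarrow> \<exists>!u. u \<in> hom C (Dom C f') A \<and> Comp C f u = f'"
    using im by (auto simp: is_image_iff[OF R])
  show fA: "f \<in> Arr C"
    using f R by (auto simp: precover_def)
  fix Z a b
  assume ab: "a \<in> hom C Z (Dom C f)" "b \<in> hom C Z (Dom C f)" "Comp C f a = Comp C f b"
  have "R (Comp C f a) g"
    using ab homD comp by fast
  moreover have "Dom C (Comp C f a) = Z"
    using homD[OF Comp_hom[OF ab(1) arr_hom[OF fA]]] by simp
  ultimately show "a = b"
    using u[of "Comp C f a"] ab f by metis
qed

lemma image_factors:
  assumes "precover C R" "is_image C R g A f" "R f' g"
  shows "factors C f' f"
proof -
  have "Dom C f = A" and "\<exists>u. u \<in> hom C (Dom C f') A \<and> Comp C f u = f'"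
    using iffD1[OF is_image_iff[OF assms(1)] assms(2)] assms(3) by blast+
  then show ?thesis
    by (auto simp: factors_def)
qed

section \<open>Subfunctors given by families of monomorphisms\<close>

lemma functorD:
  assumes "is_functor I C F"
  shows "X \<in> Ob I \<Longrightarrow> fobj F X \<in> Ob C"
    and "i \<in> Arr I \<Longrightarrow> farr F i \<in> hom C (fobj F (Dom I i)) (fobj F (Cod I i))"
    and "X \<in> Ob I \<Longrightarrow> farr F (Ide I X) = Ide C (fobj F X)"
    and "\<lbrakk>i \<in> Arr I; j \<in> Arr I; Dom I j = Cod I i\<rbrakk>
      \<Longrightarrow> farr F (Comp I j i) = Comp C (farr F j) (farr F i)"
  using assms by (auto simp: is_functor_def)

lemma ntransD:
  assumes "is_ntrans I C t"
  shows "is_functor I C (src t)" "is_functor I C (trg t)"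
    and "component t \<in> extensional (Ob I)"
    and "X \<in> Ob I \<Longrightarrow> component t X \<in> hom C (fobj (src t) X) (fobj (trg t) X)"
    and "i \<in> Arr I \<Longrightarrow> Comp C (farr (trg t) i) (component t (Dom I i))
      = Comp C (component t (Cod I i)) (farr (src t) i)"
  using assms by (auto simp: is_ntrans_def)

lemma ntrans_eqI:
  assumes "is_ntrans I C s" "is_ntrans I C t" "src s = src t" "trg s = trg t"
    and "\<And>X. X \<in> Ob I \<Longrightarrow> component s X = component t X"
  shows "s = t"
  using assms extensionalityI[OF ntransD(3)[OF assms(1)] ntransD(3)[OF assms(2)]]
  by (cases s; cases t) auto

lemma functor_cat_simps:
  "Arr (functor_cat I C) = {t. is_ntrans I C t}"
  "Dom (functor_cat I C) t = src t" "Cod (functor_cat I C) t = trg t"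
  "Ob (functor_cat I C) = {F. is_functor I C F}"
  "X \<in> Ob I \<Longrightarrow> component (Ide (functor_cat I C) F) X = Ide C (fobj F X)"
  "X \<in> Ob I \<Longrightarrow> component (Comp (functor_cat I C) s t) X = Comp C (component s X) (component t X)"
  by (auto simp: functor_cat_def)

text \<open>For monic \<open>m\<close>, such an \<open>s\<close> is the value at \<open>X\<close> of the largest subfunctor of \<open>K\<close> that is
  contained in \<open>m\<close>. Stating this by factorizations instead of pullbacks makes cores independent of
  the choice of pullbacks, and any monomorphism with the same factorizations is again a core.\<close>

definition is_core ::
    "('oi, 'mi) cat \<Rightarrow> ('oc, 'mc) cat \<Rightarrow> ('oi, 'mi, 'oc, 'mc) ftor \<Rightarrow> ('oi \<Rightarrow> 'mc) \<Rightarrow>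
      'oi \<Rightarrow> 'mc \<Rightarrow> bool" where
  "is_core I C K m X s \<longleftrightarrow> monic C s \<and> Cod C s = fobj K X \<and>
    (\<forall>V. \<forall>v \<in> hom C V (fobj K X). factors C v s \<longleftrightarrow>
      (\<forall>i \<in> {i \<in> Arr I. Dom I i = X}. factors C (Comp C (farr K i) v) (m (Cod I i))))"

locale functor_with_monos = I: category I + C: category C
  for I :: "('oi, 'mi) cat" and C :: "('oc, 'mc) cat" +
  fixes K :: "('oi, 'mi, 'oc, 'mc) ftor" and m :: "'oi \<Rightarrow> 'mc"
  assumes K: "is_functor I C K"
    and m: "Y \<in> Ob I \<Longrightarrow> monic C (m Y) \<and> Cod C (m Y) = fobj K Y"
begin

text \<open>The product intersects the inverse images \<open>w i\<close> of the \<open>m Y\<close>, and \<open>v\<close> lies in \<open>w i\<close> iff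
  \<open>K(i) v\<close> lies in \<open>m Y\<close>.\<close>

lemma core_iff_product:
  assumes pb: "\<And>i. i \<in> {i \<in> Arr I. Dom I i = X} \<Longrightarrow>
      is_pullback C (farr K i) (m (Cod I i)) (W i) (w i) (t i)"
    and s: "s \<in> hom C S (fobj K X)"
  shows "(\<exists>p. is_product (slice C (fobj K X)) {i \<in> Arr I. Dom I i = X} (\<lambda>i. (W i, w i)) (S, s) p)
    \<longleftrightarrow> is_core I C K m X s"
proof -
  let ?J = "{i \<in> Arr I. Dom I i = X}"
  have dom: "Dom C (farr K i) = fobj K X" if "i \<in> ?J" for i
    using functorD(2)[OF K, of i] that homD by fast
  have w: "monic C (w i) \<and> w i \<in> hom C (W i) (fobj K X)" if i: "i \<in> ?J" for i
    using C.pullback_of_monic[OF pb[OF i]] m I.Cod_in i pb[OF i] dom[OF i]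
    by (auto simp: is_pullback_def)
  have "factors C v (w i) \<longleftrightarrow> factors C (Comp C (farr K i) v) (m (Cod I i))"
    if "i \<in> ?J" "v \<in> hom C V (fobj K X)" for i v V
    using C.factors_pullback_iff[OF pb[OF that(1)], of v V] that(2) dom[OF that(1)] by simp
  moreover have "(\<exists>p. is_product (slice C (fobj K X)) ?J (\<lambda>i. (W i, w i)) (S, s) p) \<longleftrightarrow>
      monic C s \<and> (\<forall>V. \<forall>v \<in> hom C V (fobj K X). factors C v s \<longleftrightarrow> (\<forall>i \<in> ?J. factors C v (w i)))"
    by (rule C.slice_product_of_monos_iff) (use w s in auto)
  ultimately show ?thesis
    using homD[OF s] by (simp add: is_core_def)
qed

text \<open>The core at \<open>X\<close> is the intersection of a family indexed by the arrows out of \<open>X\<close> only, whereas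
  wide pullbacks are given for families indexed by all arrows of \<open>I\<close>.\<close>

lemma core_exists:
  assumes pb: "has_pullbacks C" and wp: "has_wide_pullbacks_of_monos C (Arr I)"
    and X: "X \<in> Ob I"
  shows "\<exists>s. is_core I C K m X s"
proof -
  let ?J = "{i \<in> Arr I. Dom I i = X}"
  have "\<exists>W w t. is_pullback C (farr K i) (m (Cod I i)) W w t" if "i \<in> Arr I" for i
    using pb functorD(2)[OF K that] m[OF I.Cod_in[OF that]] homD
    unfolding has_pullbacks_def monic_def by metis
  then obtain W w t where pb':
    "\<And>i. i \<in> Arr I \<Longrightarrow> is_pullback C (farr K i) (m (Cod I i)) (W i) (w i) (t i)"
    by metis
  \<comment> \<open>Padding the family over the arrows out of \<open>X\<close> with copies of \<open>w (Ide I X)\<close> yields a family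
    over all arrows with the same wide pullback.\<close>
  define r where "r i = (if Dom I i = X then i else Ide I X)" for i
  have r: "r i \<in> ?J" if "i \<in> Arr I" for i
    using that I.Ide_simps[OF X] by (auto simp: r_def)
  have rim: "r ` Arr I = ?J"
  proof
    show "?J \<subseteq> r ` Arr I"
    proof
      fix i assume "i \<in> ?J"
      then have "i = r i" "i \<in> Arr I" by (auto simp: r_def)
      then show "i \<in> r ` Arr I" by blast
    qed
  qed (use r in auto)
  have dom: "Dom C (farr K i) = fobj K X" if "i \<in> ?J" for i
    using functorD(2)[OF K, of i] that homD by fast
  have w: "monic C (w i) \<and> w i \<in> hom C (W i) (fobj K X)" if i: "i \<in> ?J" for i
    using C.pullback_of_monic[OF pb'] m I.Cod_in i pb'[of i] dom[OF i]
    by (auto simp: is_pullback_def)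
  have "\<exists>P p. is_wide_pullback C (fobj K X) (Arr I) (\<lambda>i. w (r i)) P p"
    using wp functorD(1)[OF K X] w[OF r] homD
    unfolding has_wide_pullbacks_of_monos_def by metis
  then obtain S s p where
    p: "is_product (slice C (fobj K X)) (Arr I) (\<lambda>i. (Dom C (w (r i)), w (r i))) (S, s) p"
    unfolding is_wide_pullback_def by auto
  then have s: "s \<in> hom C S (fobj K X)"
    by (auto simp: is_product_def Ob_slice)
  have "monic C (w (r i)) \<and> w (r i) \<in> hom C (Dom C (w (r i))) (fobj K X)" if "i \<in> Arr I" for i
    using w[OF r[OF that]] by (auto simp: hom_def)
  from C.slice_product_of_monos_iff[where m = "\<lambda>i. w (r i)", OF this s] p
  have "monic C s" and "\<And>V v. v \<in> hom C V (fobj K X) \<Longrightarrow>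
      factors C v s \<longleftrightarrow> (\<forall>i \<in> Arr I. factors C v (w (r i)))"
    by blast+
  moreover have "(\<forall>i \<in> Arr I. factors C v (w (r i))) \<longleftrightarrow> (\<forall>i \<in> ?J. factors C v (w i))" for v
    unfolding rim[symmetric] by blast
  moreover have "factors C v (w i) \<longleftrightarrow> factors C (Comp C (farr K i) v) (m (Cod I i))"
    if "i \<in> ?J" "v \<in> hom C V (fobj K X)" for i v V
    using C.factors_pullback_iff[OF pb', of i v V] that dom[OF that(1)] by simp
  ultimately have "is_core I C K m X s"
    using homD[OF s] unfolding is_core_def by simp
  then show ?thesis ..
qed

end

text \<open>The factorizations of \<open>K(i) s\<close> through \<open>s\<close> are the arrow part of the subfunctor. Because each
  \<open>s X\<close> is monic, they inherit functoriality from \<open>K\<close>.\<close>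

lemma subfunctor_of_monos:
  assumes "category I" "category C" and K: "is_functor I C K"
    and s: "\<And>X. X \<in> Ob I \<Longrightarrow> monic C (s X) \<and> Cod C (s X) = fobj K X"
    and stable: "\<And>i. i \<in> Arr I \<Longrightarrow> factors C (Comp C (farr K i) (s (Dom I i))) (s (Cod I i))"
  shows "\<exists>h. is_ntrans I C h \<and> trg h = K \<and> (\<forall>X \<in> Ob I. component h X = s X)"
proof -
  interpret I: category I by fact
  interpret C: category C by fact
  have sh: "s X \<in> hom C (Dom C (s X)) (fobj K X)" if "X \<in> Ob I" for X
    using s[OF that] by (simp add: monic_def hom_def)
  note Kh = functorD(2)[OF K]
  have "\<exists>u. u \<in> hom C (Dom C (s (Dom I i))) (Dom C (s (Cod I i))) \<and>
      Comp C (s (Cod I i)) u = Comp C (farr K i) (s (Dom I i))" if i: "i \<in> Arr I" for i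
    using stable[OF i] homD[OF C.Comp_hom[OF sh[OF I.Dom_in[OF i]] Kh[OF i]]]
    by (auto simp: factors_def)
  then obtain u where u: "\<And>i. i \<in> Arr I \<Longrightarrow>
      u i \<in> hom C (Dom C (s (Dom I i))) (Dom C (s (Cod I i))) \<and>
      Comp C (s (Cod I i)) (u i) = Comp C (farr K i) (s (Dom I i))"
    by metis
  have eqI: "a = b" if "X \<in> Ob I" "a \<in> hom C A (Dom C (s X))" "b \<in> hom C A (Dom C (s X))"
    "Comp C (s X) a = Comp C (s X) b" for X a b A
    using that monicD s by metis
  have uid: "u (Ide I X) = Ide C (Dom C (s X))" if X: "X \<in> Ob I" for X
  proof (rule eqI[OF X])
    have D: "Dom C (s X) \<in> Ob C"
      using homD[OF sh[OF X]] C.Dom_in by auto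
    show "u (Ide I X) \<in> hom C (Dom C (s X)) (Dom C (s X))"
      using u[of "Ide I X"] I.Ide_simps[OF X] by simp
    show "Ide C (Dom C (s X)) \<in> hom C (Dom C (s X)) (Dom C (s X))"
      using C.Ide_hom[OF D] .
    show "Comp C (s X) (u (Ide I X)) = Comp C (s X) (Ide C (Dom C (s X)))"
      using u[of "Ide I X"] I.Ide_simps[OF X] functorD(3)[OF K X] C.Comp_Ide[OF sh[OF X]]
        C.Ide_Comp[OF sh[OF X]] by simp
  qed
  have ucomp: "u (Comp I j i) = Comp C (u j) (u i)"
    if i: "i \<in> Arr I" and j: "j \<in> Arr I" and ij: "Dom I j = Cod I i" for i j
  proof (rule eqI)
    have ji: "Comp I j i \<in> hom I (Dom I i) (Cod I j)"
      using I.Comp_hom[OF I.arr_hom[OF i]] I.arr_hom[OF j] ij by simp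
    note ji' = homD[OF ji]
    have uj: "u j \<in> hom C (Dom C (s (Cod I i))) (Dom C (s (Cod I j)))"
      using u[OF j] ij by simp
    have Kj: "farr K j \<in> hom C (fobj K (Cod I i)) (fobj K (Cod I j))"
      using Kh[OF j] ij by simp
    show Z: "Cod I j \<in> Ob I"
      using I.Cod_in j .
    have X: "Dom I i \<in> Ob I" and Y: "Cod I i \<in> Ob I"
      using I.Dom_in I.Cod_in i by auto
    show "u (Comp I j i) \<in> hom C (Dom C (s (Dom I i))) (Dom C (s (Cod I j)))"
      using u[of "Comp I j i"] ji' by simp
    show "Comp C (u j) (u i) \<in> hom C (Dom C (s (Dom I i))) (Dom C (s (Cod I j)))"
      using C.Comp_hom[OF _ uj] u[OF i] by blast
    have "Comp C (s (Cod I j)) (Comp C (u j) (u i)) = Comp C (Comp C (s (Cod I j)) (u j)) (u i)"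
      using C.Comp_assoc[OF _ uj sh[OF Z]] u[OF i] by metis
    also have "\<dots> = Comp C (Comp C (farr K j) (s (Cod I i))) (u i)"
      using u[OF j] ij by simp
    also have "\<dots> = Comp C (farr K j) (Comp C (farr K i) (s (Dom I i)))"
      using C.Comp_assoc[OF _ sh[OF Y] Kj] u[OF i] by metis
    also have "\<dots> = Comp C (farr K (Comp I j i)) (s (Dom I i))"
      using C.Comp_assoc[OF sh[OF X] Kh[OF i] Kj] functorD(4)[OF K i j ij] by simp
    also have "\<dots> = Comp C (s (Cod I j)) (u (Comp I j i))"
      using u[of "Comp I j i"] ji' by simp
    finally show "Comp C (s (Cod I j)) (u (Comp I j i)) = Comp C (s (Cod I j)) (Comp C (u j) (u i))"
      by simp
  qed
  define H where "H = \<lparr>fobj = (\<lambda>X \<in> Ob I. Dom C (s X)), farr = (\<lambda>i \<in> Arr I. u i)\<rparr>"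
  have "is_functor I C H"
    unfolding is_functor_def
  proof (intro conjI ballI impI)
    show "fobj H \<in> Ob I \<rightarrow>\<^sub>E Ob C"
      using sh C.Dom_in homD by (fastforce simp: H_def)
    show "farr H \<in> Arr I \<rightarrow>\<^sub>E Arr C"
      using u homD by (fastforce simp: H_def)
    show "farr H i \<in> hom C (fobj H (Dom I i)) (fobj H (Cod I i))" if "i \<in> Arr I" for i
      using u[OF that] that I.Dom_in I.Cod_in by (simp add: H_def)
    show "farr H (Ide I X) = Ide C (fobj H X)" if "X \<in> Ob I" for X
      using uid[OF that] that I.Ide_simps[OF that] by (simp add: H_def)
    show "farr H (Comp I j i) = Comp C (farr H j) (farr H i)"
      if "i \<in> Arr I" "j \<in> Arr I" "Dom I j = Cod I i" for i j
      using ucomp[OF that] that homD[OF I.Comp_hom[OF I.arr_hom, of i j]] I.arr_hom[of j]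
      by (simp add: H_def)
  qed
  then have "is_ntrans I C \<lparr>src = H, trg = K, component = (\<lambda>X \<in> Ob I. s X)\<rparr>"
    using K u sh I.Dom_in I.Cod_in by (auto simp: is_ntrans_def H_def)
  then show ?thesis
    by (intro exI[of _ "\<lparr>src = H, trg = K, component = (\<lambda>X \<in> Ob I. s X)\<rparr>"]) auto
qed

text \<open>Componentwise factorizations through monomorphisms are unique, and for the same reason they are
  natural.\<close>

lemma ntrans_factors_through_monos:
  assumes "category I" "category C" and f: "is_ntrans I C f" and h: "is_ntrans I C h"
    and trg: "trg f = trg h"
    and mono: "\<And>X. X \<in> Ob I \<Longrightarrow> monic C (component h X)"
    and fac: "\<And>X. X \<in> Ob I \<Longrightarrow> factors C (component f X) (component h X)"
  shows "\<exists>!t. t \<in> hom (functor_cat I C) (src f) (src h) \<and> Comp (functor_cat I C) h t = f"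
proof -
  interpret I: category I by fact
  interpret C: category C by fact
  note fh = ntransD(4)[OF f] and hh = ntransD(4)[OF h]
  have "\<exists>u. u \<in> hom C (fobj (src f) X) (fobj (src h) X) \<and> Comp C (component h X) u = component f X"
    if "X \<in> Ob I" for X
    using fac[OF that] homD[OF fh[OF that]] homD[OF hh[OF that]] by (auto simp: factors_def)
  then obtain u where u: "\<And>X. X \<in> Ob I \<Longrightarrow> u X \<in> hom C (fobj (src f) X) (fobj (src h) X) \<and>
      Comp C (component h X) (u X) = component f X"
    by metis
  have eqI: "a = b" if "X \<in> Ob I" "a \<in> hom C A (fobj (src h) X)" "b \<in> hom C A (fobj (src h) X)"
    "Comp C (component h X) a = Comp C (component h X) b" for X a b A
    using that monicD mono homD[OF hh[OF that(1)]] by metis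
  define t where "t = \<lparr>src = src f, trg = src h, component = (\<lambda>X \<in> Ob I. u X)\<rparr>"
  have "Comp C (farr (src h) i) (u (Dom I i)) = Comp C (u (Cod I i)) (farr (src f) i)"
    if i: "i \<in> Arr I" for i
  proof (rule eqI)
    let ?X = "Dom I i" and ?Y = "Cod I i"
    have X: "?X \<in> Ob I" and Y: "?Y \<in> Ob I"
      using i I.Dom_in I.Cod_in by auto
    then show "?Y \<in> Ob I" by simp
    note hi = functorD(2)[OF ntransD(1)[OF h] i] and fi = functorD(2)[OF ntransD(1)[OF f] i]
      and ki = functorD(2)[OF ntransD(2)[OF h] i]
      and uX = conjunct1[OF u[OF X]] and uY = conjunct1[OF u[OF Y]]
    show "Comp C (farr (src h) i) (u ?X) \<in> hom C (fobj (src f) ?X) (fobj (src h) ?Y)"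
      "Comp C (u ?Y) (farr (src f) i) \<in> hom C (fobj (src f) ?X) (fobj (src h) ?Y)"
      using C.Comp_hom uX uY hi fi by blast+
    have "Comp C (component h ?Y) (Comp C (farr (src h) i) (u ?X))
        = Comp C (Comp C (farr (trg h) i) (component h ?X)) (u ?X)"
      using C.Comp_assoc[OF uX hi hh[OF Y]] ntransD(5)[OF h i] by simp
    also have "\<dots> = Comp C (farr (trg f) i) (component f ?X)"
      using C.Comp_assoc[OF uX hh[OF X] ki] u[OF X] trg by simp
    also have "\<dots> = Comp C (Comp C (component h ?Y) (u ?Y)) (farr (src f) i)"
      using ntransD(5)[OF f i] u[OF Y] by simp
    also have "\<dots> = Comp C (component h ?Y) (Comp C (u ?Y) (farr (src f) i))"
      using C.Comp_assoc[OF fi uY hh[OF Y]] by simp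
    finally show "Comp C (component h ?Y) (Comp C (farr (src h) i) (u ?X)) = \<dots>" .
  qed
  then have t: "is_ntrans I C t"
    using u ntransD(1)[OF f] ntransD(1)[OF h] I.Dom_in I.Cod_in
    by (auto simp: is_ntrans_def t_def)
  show ?thesis
  proof (intro ex1I conjI)
    show th: "t \<in> hom (functor_cat I C) (src f) (src h)"
      using t by (simp add: hom_def functor_cat_simps) (simp add: t_def)
    have "is_ntrans I C (Comp (functor_cat I C) h t)"
      using category.Comp_hom[OF category_functor_cat[OF assms(1,2)] th, of h "trg h"] h
      by (simp add: hom_def functor_cat_simps)
    then show "Comp (functor_cat I C) h t = f"
      by (rule ntrans_eqI)
        (use f trg u in \<open>auto simp: functor_cat_simps t_def\<close>, auto simp: functor_cat_def)
    fix t'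
    assume t': "t' \<in> hom (functor_cat I C) (src f) (src h) \<and> Comp (functor_cat I C) h t' = f"
    then have nt: "is_ntrans I C t'" "src t' = src f" "trg t' = src h"
      by (auto simp: hom_def functor_cat_simps)
    show "t' = t"
    proof (rule ntrans_eqI[OF nt(1) t])
      fix X assume X: "X \<in> Ob I"
      have "Comp C (component h X) (component t' X) = component f X"
        using t' X functor_cat_simps(6) by metis
      then show "component t' X = component t X"
        using eqI[OF X, of "component t' X" _ "u X"] ntransD(4)[OF nt(1) X] nt u[OF X] X
        by (simp add: t_def)
    qed (simp_all add: nt t_def)
  qed
qed

section \<open>Images in the functor category\<close>

lemma images_functor_with_monos:
  assumes "category I" "category C" and R: "precover C R"
    and comp: "\<And>f h e. \<lbrakk>R f h; e \<in> Arr C; Cod C e = Dom C f\<rbrakk> \<Longrightarrow> R (Comp C f e) h"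
    and g: "is_ntrans I C g"
    and im: "\<And>Y. Y \<in> Ob I \<Longrightarrow> is_image C R (component g Y) (M Y) (m Y)"
  shows "functor_with_monos I C (trg g) m"
proof -
  have "monic C (m Y) \<and> Cod C (m Y) = fobj (trg g) Y" if Y: "Y \<in> Ob I" for Y
  proof
    have r: "R (m Y) (component g Y)"
      using im[OF Y] by (simp add: is_image_iff[OF R])
    then show "monic C (m Y)"
      using category.image_monic[OF assms(2) R im[OF Y]] comp by blast
    show "Cod C (m Y) = fobj (trg g) Y"
      using R r ntransD(4)[OF g Y] by (auto simp: precover_def hom_def)
  qed
  then show ?thesis
    using assms(1,2) ntransD(2)[OF g]
    by (simp add: functor_with_monos_def functor_with_monos_axioms_def)
qed

text \<open>The image is built from the cores of the family \<open>m\<close>. The conclusion also records this, for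
  the given choice of \<open>m\<close>, because the description as a product refers to an arbitrary choice of
  images of the components.\<close>

lemma functor_image_exists:
  fixes I :: "('oi, 'mi) cat" and C :: "('oc, 'mc) cat"
  assumes "category I" "category C" and "has_pullbacks C"
    and "has_wide_pullbacks_of_monos C (Arr I)" and R: "precover C R"
    and comp: "\<And>f h e. \<lbrakk>R f h; e \<in> Arr C; Cod C e = Dom C f\<rbrakk> \<Longrightarrow> R (Comp C f e) h"
    and g: "is_ntrans I C g"
    and im: "\<And>Y. Y \<in> Ob I \<Longrightarrow> is_image C R (component g Y) (M Y) (m Y)"
  shows "\<exists>h. is_image (functor_cat I C) (induced_precover I C R) g (src h) h \<and>
    is_ntrans I C h \<and> (\<forall>X \<in> Ob I. is_core I C (trg g) m X (component h X))"
proof -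
  let ?K = "trg g"
  note fwm = images_functor_with_monos[OF assms(1,2) R comp g im]
  have Rm: "R (m Y) (component g Y)" "m Y \<in> Arr C" if "Y \<in> Ob I" for Y
    using im[OF that] R by (auto simp: is_image_iff[OF R] precover_def)
  interpret functor_with_monos I C ?K m by (rule fwm)
  obtain s where s: "\<And>X. X \<in> Ob I \<Longrightarrow> is_core I C ?K m X (s X)"
    using core_exists[OF assms(3,4)] by metis
  then have smono: "\<And>X. X \<in> Ob I \<Longrightarrow> monic C (s X) \<and> Cod C (s X) = fobj ?K X"
    by (simp add: is_core_def)
  have sh: "s X \<in> hom C (Dom C (s X)) (fobj ?K X)" if "X \<in> Ob I" for X
    using smono[OF that] by (simp add: monic_def hom_def)
  have score: "factors C v (s X) \<longleftrightarrow>
      (\<forall>i \<in> {i \<in> Arr I. Dom I i = X}. factors C (Comp C (farr ?K i) v) (m (Cod I i)))"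
    if "X \<in> Ob I" "v \<in> hom C V (fobj ?K X)" for X v V
    using s that unfolding is_core_def by blast
  note Kh = functorD(2)[OF K]
  \<comment> \<open>Stability: \<open>K(i) K(j) s = K(i j) s\<close> factors through \<open>m\<close> because \<open>i j\<close> is again an arrow out of
    the domain of \<open>j\<close>.\<close>
  have "factors C (Comp C (farr ?K j) (s (Dom I j))) (s (Cod I j))" if j: "j \<in> Arr I" for j
  proof -
    have X: "Dom I j \<in> Ob I" and Y: "Cod I j \<in> Ob I"
      using j I.Dom_in I.Cod_in by auto
    show ?thesis
      unfolding score[OF Y C.Comp_hom[OF sh[OF X] Kh[OF j]]]
    proof
      fix i assume i: "i \<in> {i \<in> Arr I. Dom I i = Cod I j}"
      then have ij: "Comp I i j \<in> hom I (Dom I j) (Cod I i)"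
        using I.Comp_hom[OF I.arr_hom[OF j]] I.arr_hom[of i] by auto
      have Ki: "farr ?K i \<in> hom C (fobj ?K (Cod I j)) (fobj ?K (Cod I i))"
        using Kh[of i] i by simp
      have "factors C (Comp C (farr ?K (Comp I i j)) (s (Dom I j))) (m (Cod I i))"
        using score[OF X sh[OF X]] C.factors_refl[of "s (Dom I j)"] homD[OF sh[OF X]] homD[OF ij]
        by auto
      then show "factors C (Comp C (farr ?K i) (Comp C (farr ?K j) (s (Dom I j)))) (m (Cod I i))"
        using C.Comp_assoc[OF sh[OF X] Kh[OF j] Ki] functorD(4)[OF K j, of i] i by simp
    qed
  qed
  from subfunctor_of_monos[OF assms(1,2) K smono this]
  obtain h where h: "is_ntrans I C h" "trg h = ?K" "\<And>X. X \<in> Ob I \<Longrightarrow> component h X = s X"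
    by blast
  have "induced_precover I C R h g"
  proof -
    \<comment> \<open>The identity is one of the arrows out of \<open>X\<close>, so the core lies inside \<open>m X\<close>, and closure
      under precomposition applies to \<open>s X = m X u\<close>.\<close>
    have "R (s X) (component g X)" if X: "X \<in> Ob I" for X
    proof -
      have "factors C (Comp C (farr ?K (Ide I X)) (s X)) (m X)"
        using score[OF X sh[OF X]] C.factors_refl[of "s X"] homD[OF sh[OF X]] I.Ide_simps[OF X]
        by auto
      then have "factors C (s X) (m X)"
        using functorD(3)[OF K X] C.Ide_Comp[OF sh[OF X]] by simp
      then obtain u where "u \<in> hom C (Dom C (s X)) (Dom C (m X))" "Comp C (m X) u = s X"
        by (auto simp: factors_def)
      then show ?thesis
        using comp[OF Rm(1)[OF X], of u] homD by metis
    qed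
    then show ?thesis
      using h g by (auto simp: induced_precover_def functor_cat_simps)
  qed
  moreover have "\<exists>!t. t \<in> hom (functor_cat I C) (src f) (src h) \<and> Comp (functor_cat I C) h t = f"
    if fg: "induced_precover I C R f g" for f
  proof (rule ntrans_factors_through_monos[OF assms(1,2) _ h(1)])
    show f: "is_ntrans I C f" and trg: "trg f = trg h"
      using fg h by (auto simp: induced_precover_def functor_cat_simps)
    show "monic C (component h X)" if "X \<in> Ob I" for X
      using smono that h by simp
    show "factors C (component f X) (component h X)" if X: "X \<in> Ob I" for X
    proof -
      have fX: "component f Y \<in> hom C (fobj (src f) Y) (fobj ?K Y)" if "Y \<in> Ob I" for Y
        using ntransD(4)[OF f that] trg h by simp
      have "factors C (Comp C (farr ?K i) (component f X)) (m (Cod I i))"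
        if i: "i \<in> Arr I" "Dom I i = X" for i
      proof -
        have Y: "Cod I i \<in> Ob I"
          using i I.Cod_in by auto
        have "factors C (component f (Cod I i)) (m (Cod I i))"
          using image_factors[OF R im[OF Y]] fg Y by (auto simp: induced_precover_def)
        then have "factors C (Comp C (component f (Cod I i)) (farr (src f) i)) (m (Cod I i))"
          using C.factors_precomp Rm(2)[OF Y] homD[OF functorD(2)[OF ntransD(1)[OF f] i(1)]]
            homD[OF fX[OF Y]] by simp
        then show ?thesis
          using ntransD(5)[OF f i(1)] i trg h by simp
      qed
      then show ?thesis
        using score[OF X fX[OF X]] h(3)[OF X] by simp
    qed
  qed
  ultimately have "is_image (functor_cat I C) (induced_precover I C R) g (src h) h"
    by (simp add: is_image_iff[OF precover_induced] functor_cat_simps)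
  then show ?thesis
    using h s by auto
qed

text \<open>Two images of \<open>g\<close> factor through each other, hence so do their components, and the same arrows
  factor through both. Monomorphy is transported separately, since a monomorphism of the functor
  category need not be one componentwise: \<open>h' = h a\<close>, where \<open>a\<close> is split monic with retraction \<open>b\<close>.\<close>

lemma functor_image_components_core:
  assumes "category I" "category C" and K: "is_functor I C K"
    and im: "is_image (functor_cat I C) (induced_precover I C R) g H h"
    and im': "is_image (functor_cat I C) (induced_precover I C R) g H' h'"
    and X: "X \<in> Ob I" and core: "is_core I C K m X (component h X)"
  shows "is_core I C K m X (component h' X)"
proof -
  interpret C: category C by fact
  interpret F: category "functor_cat I C"
    using category_functor_cat[OF assms(1,2)] .
  let ?F = "functor_cat I C" and ?R = "induced_precover I C R"
  note un = iffD1[OF is_image_iff[OF precover_induced]]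
  have Rh: "?R h g" "?R h' g" and D: "src h = H" "src h' = H'"
    using un[OF im] un[OF im'] by (simp_all add: functor_cat_simps)
  then have nt: "is_ntrans I C h" "is_ntrans I C h'" "trg h = trg g" "trg h' = trg g"
    by (simp_all add: induced_precover_def functor_cat_simps)
  have univ: "\<exists>!u. u \<in> hom ?F (src f) H \<and> Comp ?F h u = f"
    and univ': "\<exists>!u. u \<in> hom ?F (src f) H' \<and> Comp ?F h' u = f" if "?R f g" for f
    using un[OF im] un[OF im'] that by (simp_all add: functor_cat_simps)
  obtain a where a: "a \<in> hom ?F H' H" "Comp ?F h a = h'"
    using univ[OF Rh(2)] D by auto
  obtain b where b: "b \<in> hom ?F H H'" "Comp ?F h' b = h"
    using univ'[OF Rh(1)] D by auto
  have h'h: "h' \<in> hom ?F H' (trg g)"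
    using nt D by (simp add: hom_def functor_cat_simps)
  have "Comp ?F b a = Ide ?F H'"
  proof -
    have H': "H' \<in> Ob ?F"
      using F.Dom_in homD[OF h'h] by auto
    have "Comp ?F h' (Comp ?F b a) = h'"
      using F.Comp_assoc[OF a(1) b(1) h'h] a b by simp
    moreover have "Comp ?F h' (Ide ?F H') = h'"
      using F.Comp_Ide[OF h'h] .
    moreover have "\<exists>!u. u \<in> hom ?F H' H' \<and> Comp ?F h' u = h'"
      using univ'[OF Rh(2)] D by simp
    ultimately show ?thesis
      using F.Comp_hom[OF a(1) b(1)] F.Ide_hom[OF H'] by blast
  qed
  then have ba: "Comp C (component b X) (component a X) = Ide C (fobj H' X)"
    using functor_cat_simps(5,6)[OF X] by metis
  have hX: "component h X \<in> hom C (fobj H X) (fobj (trg g) X)"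
    and h'X: "component h' X \<in> hom C (fobj H' X) (fobj (trg g) X)"
    using ntransD(4)[OF _ X] nt D by metis+
  have aX: "component a X \<in> hom C (fobj H' X) (fobj H X)"
    and bX: "component b X \<in> hom C (fobj H X) (fobj H' X)"
    using a(1) b(1) ntransD(4)[OF _ X] by (auto simp: hom_def functor_cat_simps)
  have ha: "Comp C (component h X) (component a X) = component h' X"
    and hb: "Comp C (component h' X) (component b X) = component h X"
    using a(2) b(2) functor_cat_simps(6)[OF X] by metis+
  have mono: "monic C (component h X)" and cod: "Cod C (component h X) = fobj K X"
    using core by (auto simp: is_core_def)
  have "monic C (component h' X)"
    unfolding monic_def
  proof (intro conjI allI ballI impI)
    show "component h' X \<in> Arr C"
      using homD[OF h'X] by simp
    fix Z x y
    assume "x \<in> hom C Z (Dom C (component h' X))" "y \<in> hom C Z (Dom C (component h' X))"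
      and xy: "Comp C (component h' X) x = Comp C (component h' X) y"
    then have x: "x \<in> hom C Z (fobj H' X)" and y: "y \<in> hom C Z (fobj H' X)"
      using homD[OF h'X] by auto
    have "Comp C (component h X) (Comp C (component a X) x)
        = Comp C (component h X) (Comp C (component a X) y)"
      using C.Comp_assoc[OF x aX hX] C.Comp_assoc[OF y aX hX] ha xy by simp
    then have "Comp C (component a X) x = Comp C (component a X) y"
      using monicD[OF mono] C.Comp_hom[OF x aX] C.Comp_hom[OF y aX] homD[OF hX] by metis
    then show "x = y"
      using C.Comp_assoc[OF x aX bX] C.Comp_assoc[OF y aX bX] ba C.Ide_Comp[OF x] C.Ide_Comp[OF y]
      by simp
  qed
  moreover have "factors C (component h' X) (component h X)"
    "factors C (component h X) (component h' X)"
    using aX bX ha hb homD[OF hX] homD[OF h'X] by (auto simp: factors_def)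
  then have "factors C v (component h' X) \<longleftrightarrow> factors C v (component h X)" for v
    using C.factors_trans homD[OF hX] homD[OF h'X] by blast
  ultimately show ?thesis
    using core homD[OF hX] homD[OF h'X] by (simp add: is_core_def)
qed

theorem theorem2p1:
  fixes I :: "('oi, 'mi) cat" and C :: "('oc, 'mc) cat"
    and R :: "'mc \<Rightarrow> 'mc \<Rightarrow> bool"
    and B K :: "('oi, 'mi, 'oc, 'mc) ftor" and g :: "('oi, 'mi, 'oc, 'mc) ntrans"
  assumes "category I" and "category C"
    and "has_pullbacks C"
    and "has_wide_pullbacks_of_monos C (Arr I)"
    and "precover C R"
    and "\<And>f h e. \<lbrakk>R f h; e \<in> Arr C; Cod C e = Dom C f\<rbrakk> \<Longrightarrow> R (Comp C f e) h"
    and "g \<in> hom (functor_cat I C) B K"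
    and "\<And>X. X \<in> Ob I \<Longrightarrow> \<exists>A f. is_image C R (component g X) A f"
  shows "(\<exists>H h. is_image (functor_cat I C) (induced_precover I C R) g H h) \<and>
    (\<forall>H h. is_image (functor_cat I C) (induced_precover I C R) g H h \<longrightarrow>
      (\<forall>X \<in> Ob I. \<forall>M m W w t.
        (\<forall>Y \<in> Ob I. is_image C R (component g Y) (M Y) (m Y)) \<and>
        (\<forall>i \<in> {i \<in> Arr I. Dom I i = X}.
          is_pullback C (farr K i) (m (Cod I i)) (W i) (w i) (t i)) \<longrightarrow>
        (\<forall>i \<in> {i \<in> Arr I. Dom I i = X}. monic C (w i)) \<and>
        (\<exists>p. is_product (slice C (fobj K X)) {i \<in> Arr I. Dom I i = X}
          (\<lambda>i. (W i, w i)) (fobj H X, component h X) p)))"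
proof -
  from assms(7) have g: "is_ntrans I C g" "trg g = K"
    by (auto simp: hom_def functor_cat_simps)
  show ?thesis
  proof (intro conjI allI impI ballI; (elim conjE)?)
    obtain M m where "\<And>Y. Y \<in> Ob I \<Longrightarrow> is_image C R (component g Y) (M Y) (m Y)"
      using assms(8) by metis
    from functor_image_exists[OF assms(1-5) assms(6) g(1) this]
    show "\<exists>H h. is_image (functor_cat I C) (induced_precover I C R) g H h"
      by blast
  next
    fix H h X M m W w t i
    assume im: "\<forall>Y \<in> Ob I. is_image C R (component g Y) (M Y) (m Y)"
      and pb: "\<forall>i \<in> {i \<in> Arr I. Dom I i = X}.
        is_pullback C (farr K i) (m (Cod I i)) (W i) (w i) (t i)"
      and i: "i \<in> {i \<in> Arr I. Dom I i = X}"
    interpret functor_with_monos I C K m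
      using images_functor_with_monos[OF assms(1,2,5) assms(6) g(1)] im g(2) by blast
    show "monic C (w i)"
      using C.pullback_of_monic pb i m I.Cod_in by blast
  next
    fix H h X M m W w t
    assume him: "is_image (functor_cat I C) (induced_precover I C R) g H h"
      and X: "X \<in> Ob I" and im: "\<forall>Y \<in> Ob I. is_image C R (component g Y) (M Y) (m Y)"
      and pb: "\<forall>i \<in> {i \<in> Arr I. Dom I i = X}.
        is_pullback C (farr K i) (m (Cod I i)) (W i) (w i) (t i)"
    interpret functor_with_monos I C K m
      using images_functor_with_monos[OF assms(1,2,5) assms(6) g(1)] im g(2) by blast
    obtain h0 where
      "is_image (functor_cat I C) (induced_precover I C R) g (src h0) h0"
      "is_core I C K m X (component h0 X)"
      using functor_image_exists[OF assms(1-5) assms(6) g(1), of M m] im X g(2) by blast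
    then have core: "is_core I C K m X (component h X)"
      using functor_image_components_core[OF assms(1,2) K _ him X] by blast
    have "is_ntrans I C h" "src h = H" "trg h = K"
      using him g(2)
      by (auto simp: is_image_iff[OF precover_induced] induced_precover_def functor_cat_simps)
    then have "component h X \<in> hom C (fobj H X) (fobj K X)"
      using ntransD(4)[of I C h, OF _ X] by simp
    then show "\<exists>p. is_product (slice C (fobj K X)) {i \<in> Arr I. Dom I i = X}
          (\<lambda>i. (W i, w i)) (fobj H X, component h X) p"
      using core_iff_product pb core by blast
  qed
qed

end
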